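(* Let $p$ be a prime, let $H\cong2\cdot\mathrm{S}_4$ be a subgroup of $\mathrm{SL}(2,p)$, and let $x\in\mathrm{SL}(2,p)$ satisfy $\langle H,x\rangle=\mathrm{SL}(2,p)$, $x^2\in H$ and $[H:x^{-1}Hx\cap H]=3$. Let $S=H\cup(xH\cap Hx)$, and let $T=S\cup\{y,y^{-1}\}$ for some $y\in\mathrm{SL}(2,p)$ with $y\notin S$. Then $\Delta(T)>\Delta(S)$.
   Context: For a subset $S$ of $\mathrm{SL}(2,p)$, $S^3=\{abc: a,b,c\in S\}$ and $\Delta(S)=\log(|S^3|)/\log(|S|)$. Here $2\cdot\mathrm{S}_4$ denotes the binary octahedral group of order 48, i.e. the double cover of $\mathrm{S}_4$ occurring as the full preimage in $\mathrm{SL}(2,p)$ of a subgroup $\mathrm{S}_4$ of $\mathrm{PSL}(2,p)$. *)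

theory Defs
  imports
    "HOL-Analysis.Determinants"
    "HOL-Algebra.Sym_Groups"
    "Berlekamp_Zassenhaus.Finite_Field"
begin

text \<open>
  The prime field with \<open>p\<close> elements is the type \<open>'p mod_ring\<close> with \<open>'p :: prime_card\<close>: its elements
  are the residues modulo \<open>p = CARD('p)\<close>, and \<open>prime_card\<close> is the class of the types of prime
  cardinality. So \<open>SL(2,p)\<close> is \<open>SL2 :: ('p mod_ring ^ 2 ^ 2) monoid\<close>.
\<close>

definition SL2 :: "('a::field ^ 2 ^ 2) monoid" where
  "SL2 = \<lparr>carrier = {A. det A = 1}, mult = (**), one = mat 1\<rparr>"

lemma group_SL2: "group (SL2 :: ('a::field ^ 2 ^ 2) monoid)"
proof (rule groupI)
  fix A :: "'a ^ 2 ^ 2"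
  assume A: "A \<in> carrier SL2"
  then have "invertible A" by (simp add: SL2_def invertible_det_nz)
  then obtain B where B: "A ** B = mat 1" "B ** A = mat 1"
    unfolding invertible_def by blast
  have "det B * det A = 1" using B(2) by (metis det_mul det_I)
  then have "B \<in> carrier SL2" using A by (simp add: SL2_def)
  then show "\<exists>B\<in>carrier SL2. B \<otimes>\<^bsub>SL2\<^esub> A = \<one>\<^bsub>SL2\<^esub>"
    using B(2) by (auto simp: SL2_def)
qed (auto simp: SL2_def det_mul matrix_mul_assoc)

definition scalars_SL2 :: "('a::field ^ 2 ^ 2) set" where
  "scalars_SL2 = {A \<in> carrier SL2. \<exists>c. A = mat c}"

definition PSL2 :: "('a::field ^ 2 ^ 2) set monoid" where
  "PSL2 = SL2 Mod scalars_SL2"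

definition proj_SL2 :: "'a::field ^ 2 ^ 2 \<Rightarrow> ('a ^ 2 ^ 2) set" where
  "proj_SL2 A = scalars_SL2 #>\<^bsub>SL2\<^esub> A"

text \<open>
  \<open>G\<close> is isomorphic to \<open>2\<cdot>S\<^sub>4\<close>, the full preimage in \<open>SL(2,p)\<close> of a
  subgroup \<open>S\<^sub>4\<close> of \<open>PSL(2,p)\<close>.
\<close>

definition iso_double_cover_S4 :: "('p::prime_card mod_ring ^ 2 ^ 2) monoid \<Rightarrow> bool" where
  "iso_double_cover_S4 G \<longleftrightarrow>
    (\<exists>K. subgroup K (PSL2 :: ('p mod_ring ^ 2 ^ 2) set monoid) \<and>
         PSL2\<lparr>carrier := K\<rparr> \<cong> sym_group 4 \<and>
         G \<cong> SL2\<lparr>carrier := {A \<in> carrier SL2. proj_SL2 A \<in> K}\<rparr>)"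

definition subgroup_index :: "('g, 'r) monoid_scheme \<Rightarrow> 'g set \<Rightarrow> 'g set \<Rightarrow> nat" where
  "subgroup_index G H K = card (rcosets\<^bsub>G\<lparr>carrier := H\<rparr>\<^esub> K)"

definition tripling_exponent :: "('g, 'r) monoid_scheme \<Rightarrow> 'g set \<Rightarrow> real" where
  "tripling_exponent G S = ln (real (card (S <#>\<^bsub>G\<^esub> S <#>\<^bsub>G\<^esub> S))) / ln (real (card S))"

end

theory Submission
  imports Defs
begin

text \<open>
  The cosets of \<open>H\<close> are the vertices of a graph on which \<open>SL(2,p)\<close> acts, with \<open>gH\<close> joined to
  \<open>g'H\<close> when \<open>g' \<in> gHxH\<close>. Since \<open>x\<^sup>2 \<in> H\<close> this relation is symmetric, and since
  \<open>M = H \<inter> xHx\<^sup>-\<^sup>1\<close> has index 3 in \<open>H\<close> the graph is cubic. Write \<open>v\<close> for the vertex \<open>H\<close> and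
  \<open>w\<close> for its neighbour \<open>xH\<close>, which \<open>x\<close> interchanges. Then \<open>H\<close> and \<open>xHx\<^sup>-\<^sup>1 = xHx\<close> are the
  stabilisers of \<open>v\<close> and \<open>w\<close>, and \<open>S = H \<union> xM\<close>. The group \<open>H\<close> has order 48, so \<open>M\<close> has
  order \<open>m = 16\<close> and \<open>S\<close> has \<open>4m = 64\<close> elements.

  All of \<open>S\<^sup>3\<close> lies in the union of \<open>B = H \<union> HxH\<close>, the elements that move \<open>v\<close> by at most one
  step, and of the stabiliser of \<open>w\<close>; counting gives \<open>|S\<^sup>3| \<le> 12m + 2m = 224\<close>. The point is that \<open>T\<^sup>3\<close>
  always has at least \<open>m\<close> further elements (\<open>card_S_cubed_less\<close>):

  \<^item> If \<open>y \<notin> B\<close>, the \<open>3m\<close> elements of \<open>Hy\<close> avoid \<open>B\<close>, and at most \<open>2m\<close> of them can lie in \<open>S\<^sup>3\<close>.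
  \<^item> If \<open>y = hxk \<in> B\<close>, then one of \<open>y\<close> and \<open>y\<^sup>-\<^sup>1\<close> moves \<open>v\<close> to a neighbour other than \<open>w\<close>, so
    one may take \<open>h \<notin> M\<close>. Let \<open>P\<close> be the set of the at most \<open>2m\<close> elements that fix \<open>w\<close> but lie
    outside \<open>B\<close>. Then \<open>hP \<subseteq> hxHx \<subseteq> T\<^sup>3\<close> is disjoint from \<open>B\<close>. If \<open>P\<close> is nonempty, \<open>hP \<noteq> P\<close>:
    otherwise the stabiliser of \<open>P\<close> in \<open>H\<close> contains \<open>M\<close> properly, hence is \<open>H\<close> by maximality of
    \<open>M\<close>, and \<open>P\<close> contains a coset of \<open>H\<close>, which has \<open>3m > 2m\<close> elements. As \<open>hP\<close> and \<open>P\<close> are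
    unions of left cosets of \<open>M\<close>, at least \<open>m\<close> elements of \<open>hP\<close> are new.

  The set \<open>P\<close> is nonempty, for otherwise \<open>B\<close> would be a subgroup and thus all of \<open>SL(2,p)\<close> (the
  graph would be complete on four vertices); then \<open>|SL(2,p)|\<close> is a multiple of 48 between 64 and
  192, so \<open>p\<close>, a divisor of it, is 2 or 3, but then there are only \<open>p\<^sup>4 \<le> 81\<close> matrices.

  Finally, \<open>T\<close> has at most 66 elements, and raising the size from 64 to at most 66 is outweighed by
  raising that of the triple product by 16 from at most 224 (\<open>log_ratio_less\<close>).
\<close>

section \<open>A subgroup and an element with intersection of index three\<close>

locale index_three_pair = group G for G (structure) +
  fixes H :: "'a set" and x :: 'a
  assumes finite_G: "finite (carrier G)"
    and subgroup_H: "subgroup H G"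
    and x_in_G: "x \<in> carrier G"
    and square_in_H: "x \<otimes> x \<in> H"
    and index_three: "subgroup_index G H (((inv x <# H) #> x) \<inter> H) = 3"
begin

text \<open>
  The stabiliser of \<open>w\<close>: the conjugate \<open>xHx\<^sup>-\<^sup>1\<close>.
\<close>

definition conj_H :: "'a set" where
  "conj_H = {g \<in> carrier G. inv x \<otimes> g \<otimes> x \<in> H}"

definition M :: "'a set" where
  "M = H \<inter> conj_H"

text \<open>
  The elements that move \<open>v\<close> to itself or to a neighbour.
\<close>

definition ball :: "'a set" where
  "ball = H \<union> {h \<otimes> x \<otimes> k | h k. h \<in> H \<and> k \<in> H}"

text \<open>
  The elements that fix \<open>w\<close> but send \<open>v\<close> neither to itself nor to a neighbour.
\<close>

definition far :: "'a set" where
  "far = conj_H - ball"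

definition S :: "'a set" where
  "S = H \<union> ((x <# H) \<inter> (H #> x))"

lemma H_sub: "h \<in> H \<Longrightarrow> h \<in> carrier G"
  using subgroup_H by (rule subgroup.mem_carrier)

lemma H_closed: "h \<in> H \<Longrightarrow> k \<in> H \<Longrightarrow> h \<otimes> k \<in> H"
  using subgroup_H by (rule subgroup.m_closed)

lemma H_inv: "h \<in> H \<Longrightarrow> inv h \<in> H"
  using subgroup_H by (rule subgroup.m_inv_closed)

lemma H_one: "\<one> \<in> H"
  using subgroup_H by (rule subgroup.one_closed)

lemma cancel_inv_left: "a \<in> carrier G \<Longrightarrow> b \<in> carrier G \<Longrightarrow> inv a \<otimes> (a \<otimes> b) = b"
  by (simp add: m_assoc[symmetric])

lemma cancel_left_inv: "a \<in> carrier G \<Longrightarrow> b \<in> carrier G \<Longrightarrow> a \<otimes> (inv a \<otimes> b) = b"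
  by (simp add: m_assoc[symmetric])

lemmas group_simps = m_assoc inv_mult_group cancel_inv_left cancel_left_inv

text \<open>
  Conjugation by \<open>x\<close> and by \<open>x\<^sup>-\<^sup>1\<close> differ by conjugation by \<open>x\<^sup>2 \<in> H\<close>, so the two possible
  definitions of the arc stabiliser \<open>M\<close> agree.
\<close>

lemma conj_mem_H_iff:
  assumes "g \<in> carrier G"
  shows "x \<otimes> g \<otimes> inv x \<in> H \<longleftrightarrow> inv x \<otimes> g \<otimes> x \<in> H"
proof
  have c: "x \<otimes> x \<in> carrier G" using x_in_G by simp
  assume "x \<otimes> g \<otimes> inv x \<in> H"
  then have "inv (x \<otimes> x) \<otimes> (x \<otimes> g \<otimes> inv x) \<otimes> (x \<otimes> x) \<in> H"
    using square_in_H by (blast intro: H_closed H_inv)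
  then show "inv x \<otimes> g \<otimes> x \<in> H"
    using x_in_G assms by (simp add: group_simps)
next
  assume "inv x \<otimes> g \<otimes> x \<in> H"
  then have "(x \<otimes> x) \<otimes> (inv x \<otimes> g \<otimes> x) \<otimes> inv (x \<otimes> x) \<in> H"
    using square_in_H by (blast intro: H_closed H_inv)
  then show "x \<otimes> g \<otimes> inv x \<in> H"
    using x_in_G assms by (simp add: group_simps)
qed

lemma subgroup_conj_H: "subgroup conj_H G"
proof (rule subgroupI)
  have "\<one> \<in> conj_H" using x_in_G H_one by (simp add: conj_H_def)
  then show "conj_H \<noteq> {}" by blast
next
  fix a assume "a \<in> conj_H"
  then show "inv a \<in> conj_H"
    using x_in_G H_inv[of "inv x \<otimes> a \<otimes> x"] by (auto simp: conj_H_def group_simps)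
next
  fix a b assume "a \<in> conj_H" "b \<in> conj_H"
  then show "a \<otimes> b \<in> conj_H"
    using x_in_G H_closed[of "inv x \<otimes> a \<otimes> x" "inv x \<otimes> b \<otimes> x"]
    by (auto simp: conj_H_def group_simps)
qed (auto simp: conj_H_def)

lemma subgroup_M: "subgroup M G"
  unfolding M_def using subgroup_H subgroup_conj_H by (rule subgroups_Inter_pair)

lemma M_sub: "m \<in> M \<Longrightarrow> m \<in> carrier G"
  using subgroup_M by (rule subgroup.mem_carrier)

lemma M_conj: "m \<in> M \<Longrightarrow> x \<otimes> m \<otimes> inv x \<in> H"
  using conj_mem_H_iff[of m] by (simp add: M_def conj_H_def)

lemma finite_H: "finite H" and finite_conj_H: "finite conj_H" and finite_M: "finite M"
  using finite_G finite_subset subgroup.subset subgroup_H subgroup_conj_H subgroup_M by metis+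

lemma card_conj_H: "card conj_H = card H"
proof -
  have "bij_betw (\<lambda>g. inv x \<otimes> g \<otimes> x) conj_H H"
    by (rule bij_betwI[where g = "\<lambda>h. x \<otimes> h \<otimes> inv x"])
       (use x_in_G H_sub in \<open>auto simp: conj_H_def group_simps\<close>)
  then show ?thesis by (rule bij_betw_same_card)
qed

lemma M_eq_intersection: "((inv x <# H) #> x) \<inter> H = M"
proof (intro equalityI subsetI)
  fix g assume "g \<in> ((inv x <# H) #> x) \<inter> H"
  then obtain h where h: "h \<in> H" "g = inv x \<otimes> h \<otimes> x" "g \<in> H"
    by (auto simp: l_coset_def r_coset_def)
  then have "x \<otimes> g \<otimes> inv x = h" using x_in_G H_sub by (simp add: group_simps)
  then show "g \<in> M" using h H_sub conj_mem_H_iff[of g] by (simp add: M_def conj_H_def)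
next
  fix g assume "g \<in> M"
  then have g: "g \<in> H" "g \<in> carrier G" "x \<otimes> g \<otimes> inv x \<in> H"
    using H_sub conj_mem_H_iff[of g] by (auto simp: M_def conj_H_def)
  have "g = inv x \<otimes> (x \<otimes> g \<otimes> inv x) \<otimes> x" using g x_in_G by (simp add: group_simps)
  then show "g \<in> ((inv x <# H) #> x) \<inter> H"
    using g by (auto simp: l_coset_def r_coset_def)
qed

lemma card_cosets_M: "card (rcosets\<^bsub>G\<lparr>carrier := H\<rparr>\<^esub> M) = 3"
  using index_three by (simp add: subgroup_index_def M_eq_intersection)

lemma group_H: "group (G\<lparr>carrier := H\<rparr>)"
  using subgroup_H by (rule subgroup_imp_group)

lemma card_H: "card H = 3 * card M"
proof -
  have "subgroup M (G\<lparr>carrier := H\<rparr>)"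
    using subgroup_M subgroup_H by (rule subgroup_incl) (simp add: M_def)
  then show ?thesis
    using group.lagrange[OF group_H, of M] card_cosets_M by (simp add: Coset.order_def)
qed

lemma card_M_pos: "card M > 0"
  using finite_M subgroup.one_closed[OF subgroup_M] by (auto simp: card_gt_0_iff)

lemma x_notin_H: "x \<notin> H"
proof
  assume "x \<in> H"
  then have "M = H" using H_closed H_inv H_sub by (auto simp: M_def conj_H_def)
  then show False using card_H card_M_pos by simp
qed

lemma card_l_translate:
  assumes "a \<in> carrier G" "B \<subseteq> carrier G"
  shows "card ((\<lambda>b. a \<otimes> b) ` B) = card B"
  by (rule card_image) (use assms in \<open>auto intro!: inj_onI simp: subset_iff\<close>)

lemma ball_sub: "g \<in> ball \<Longrightarrow> g \<in> carrier G"
  using x_in_G H_sub by (auto simp: ball_def)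

lemma finite_ball: "finite ball"
  using finite_G ball_sub by (meson finite_subset subsetI)

lemma ball_mult_left: "h \<in> H \<Longrightarrow> g \<in> ball \<Longrightarrow> h \<otimes> g \<in> ball"
proof -
  assume h: "h \<in> H" and "g \<in> ball"
  then consider "g \<in> H" | a b where "a \<in> H" "b \<in> H" "g = a \<otimes> x \<otimes> b"
    by (auto simp: ball_def)
  then show ?thesis
  proof cases
    case 1 then show ?thesis using h H_closed by (simp add: ball_def)
  next
    case 2
    then have "h \<otimes> g = (h \<otimes> a) \<otimes> x \<otimes> b" using h x_in_G H_sub by (simp add: m_assoc)
    then show ?thesis using 2 h H_closed unfolding ball_def by blast
  qed
qed

lemma ball_mult_right: "h \<in> H \<Longrightarrow> g \<in> ball \<Longrightarrow> g \<otimes> h \<in> ball"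
proof -
  assume h: "h \<in> H" and "g \<in> ball"
  then consider "g \<in> H" | a b where "a \<in> H" "b \<in> H" "g = a \<otimes> x \<otimes> b"
    by (auto simp: ball_def)
  then show ?thesis
  proof cases
    case 1 then show ?thesis using h H_closed by (simp add: ball_def)
  next
    case 2
    then have "g \<otimes> h = a \<otimes> x \<otimes> (b \<otimes> h)" using h x_in_G H_sub by (simp add: m_assoc)
    then show ?thesis using 2 h H_closed unfolding ball_def by blast
  qed
qed

lemma inv_ball: "g \<in> ball \<Longrightarrow> inv g \<in> ball"
proof -
  assume "g \<in> ball"
  then consider "g \<in> H" | a b where "a \<in> H" "b \<in> H" "g = a \<otimes> x \<otimes> b"
    by (auto simp: ball_def)
  then show ?thesis
  proof cases
    case 1 then show ?thesis using H_inv by (simp add: ball_def)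
  next
    case 2
    then have "inv g = inv b \<otimes> x \<otimes> (inv (x \<otimes> x) \<otimes> inv a)"
      using x_in_G H_sub by (simp add: group_simps)
    then show ?thesis using 2 H_closed H_inv square_in_H unfolding ball_def by blast
  qed
qed

lemma ball_cancel_left: "h \<in> H \<Longrightarrow> g \<in> carrier G \<Longrightarrow> h \<otimes> g \<in> ball \<Longrightarrow> g \<in> ball"
  using ball_mult_left[of "inv h" "h \<otimes> g"] H_inv H_sub by (simp add: group_simps)

lemma ball_cancel_right: "h \<in> H \<Longrightarrow> g \<in> carrier G \<Longrightarrow> g \<otimes> h \<in> ball \<Longrightarrow> g \<in> ball"
  using ball_mult_right[of "inv h" "g \<otimes> h"] H_inv H_sub by (simp add: group_simps)

text \<open>
  Modulo \<open>H\<close> on the left, \<open>h x k\<close> depends only on the coset \<open>M k\<close>, because \<open>x M x\<^sup>-\<^sup>1 \<subseteq> H\<close>. There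
  are three such cosets, so \<open>H x H\<close> is covered by three right cosets of \<open>H\<close>.
\<close>

lemma card_ball: "card ball \<le> 12 * card M"
proof -
  let ?R = "rcosets\<^bsub>G\<lparr>carrier := H\<rparr>\<^esub> M"
  define r where "r C = (SOME c. c \<in> C)" for C :: "'a set"
  have "{h \<otimes> x \<otimes> k | h k. h \<in> H \<and> k \<in> H} \<subseteq> (\<Union>C\<in>?R. (\<lambda>h. h \<otimes> (x \<otimes> r C)) ` H)"
  proof clarify
    fix h k assume hk: "h \<in> H" "k \<in> H"
    let ?C = "M #> k"
    have C: "?C \<in> ?R" using hk by (auto simp: RCOSETS_def r_coset_def)
    have "k \<in> ?C" using hk H_sub subgroup.one_closed[OF subgroup_M]
      by (force simp: r_coset_def)
    then have "r ?C \<in> ?C" unfolding r_def by (rule someI)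
    then obtain m where m: "m \<in> M" "r ?C = m \<otimes> k" by (auto simp: r_coset_def)
    have mH: "x \<otimes> inv m \<otimes> inv x \<in> H"
      using m subgroup.m_inv_closed[OF subgroup_M] M_conj by blast
    have "h \<otimes> x \<otimes> k = (h \<otimes> (x \<otimes> inv m \<otimes> inv x)) \<otimes> (x \<otimes> r ?C)"
      using hk H_sub x_in_G m M_sub by (simp add: group_simps)
    moreover have "h \<otimes> (x \<otimes> inv m \<otimes> inv x) \<in> H" using hk mH H_closed by blast
    ultimately show "h \<otimes> x \<otimes> k \<in> (\<Union>C\<in>?R. (\<lambda>h. h \<otimes> (x \<otimes> r C)) ` H)"
      using C by blast
  qed
  moreover have finR: "finite ?R" using card_cosets_M card.infinite by fastforce
  ultimately have "card {h \<otimes> x \<otimes> k | h k. h \<in> H \<and> k \<in> H} \<le> card (\<Union>C\<in>?R. (\<lambda>h. h \<otimes> (x \<otimes> r C)) ` H)"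
    by (intro card_mono) (auto simp: finite_H)
  also have "\<dots> \<le> (\<Sum>C\<in>?R. card ((\<lambda>h. h \<otimes> (x \<otimes> r C)) ` H))"
    using finR by (rule card_UN_le)
  also have "\<dots> \<le> (\<Sum>C\<in>?R. card H)"
    by (intro sum_mono card_image_le finite_H)
  also have "\<dots> = 9 * card M" by (simp add: card_cosets_M card_H)
  finally show ?thesis
    using card_Un_le[of H "{h \<otimes> x \<otimes> k | h k. h \<in> H \<and> k \<in> H}"] card_H by (simp add: ball_def)
qed

lemma card_conj_H_minus: "B \<supseteq> H \<Longrightarrow> card (conj_H - B) \<le> 2 * card M"
proof -
  assume "B \<supseteq> H"
  then have "card (conj_H - B) \<le> card (conj_H - M)"
    by (intro card_mono) (auto simp: M_def finite_conj_H)
  also have "\<dots> = 2 * card M"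
    using card_Diff_subset[of M conj_H] finite_M card_conj_H card_H by (auto simp: M_def)
  finally show ?thesis .
qed

lemma S_minus_H:
  assumes "a \<in> S" "a \<notin> H"
  shows "\<exists>k\<in>H. \<exists>l\<in>H. a = x \<otimes> k \<and> a = l \<otimes> x"
  using assms by (auto simp: S_def l_coset_def r_coset_def)

lemma S_eq: "S = H \<union> (\<lambda>m. x \<otimes> m) ` M"
proof -
  have "(x <# H) \<inter> (H #> x) = (\<lambda>m. x \<otimes> m) ` M"
  proof (intro equalityI subsetI)
    fix a assume "a \<in> (x <# H) \<inter> (H #> x)"
    then obtain k l where kl: "k \<in> H" "l \<in> H" "a = x \<otimes> k" "a = l \<otimes> x"
      by (auto simp: l_coset_def r_coset_def)
    have "x \<otimes> k \<otimes> inv x = l" using kl x_in_G H_sub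
      by (metis inv_solve_right' m_closed)
    then have "k \<in> M" using kl H_sub conj_mem_H_iff[of k] by (simp add: M_def conj_H_def)
    then show "a \<in> (\<lambda>m. x \<otimes> m) ` M" using kl by blast
  next
    fix a assume "a \<in> (\<lambda>m. x \<otimes> m) ` M"
    then obtain m where m: "m \<in> M" "a = x \<otimes> m" by blast
    then have "x \<otimes> m \<otimes> inv x \<in> H" using M_conj by blast
    moreover have "a = (x \<otimes> m \<otimes> inv x) \<otimes> x" using m M_sub x_in_G by (simp add: group_simps)
    ultimately show "a \<in> (x <# H) \<inter> (H #> x)"
      using m by (auto simp: l_coset_def r_coset_def M_def)
  qed
  then show ?thesis by (simp add: S_def)
qed

lemma S_sub: "a \<in> S \<Longrightarrow> a \<in> carrier G"
  using H_sub M_sub x_in_G by (auto simp: S_eq)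

lemma card_S: "card S = 4 * card M"
proof -
  have "H \<inter> (\<lambda>m. x \<otimes> m) ` M = {}"
  proof -
    have False if m: "m \<in> M" "x \<otimes> m \<in> H" for m
    proof -
      have "x = (x \<otimes> m) \<otimes> inv m" using m M_sub x_in_G by (simp add: group_simps)
      then show False using m H_closed[of "x \<otimes> m" "inv m"] H_inv[of m] x_notin_H by (simp add: M_def)
    qed
    then show ?thesis by blast
  qed
  then have "card S = card H + card ((\<lambda>m. x \<otimes> m) ` M)"
    unfolding S_eq by (intro card_Un_disjoint) (auto simp: finite_H finite_M)
  then show ?thesis using card_l_translate[of x M] x_in_G M_sub card_H by auto
qed

lemma S_sub_ball: "a \<in> S \<Longrightarrow> a \<in> ball"
proof (cases "a \<in> H")
  case False
  assume "a \<in> S"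
  then obtain k where "k \<in> H" "a = x \<otimes> k" using False S_minus_H by meson
  then have "k \<in> H" "a = \<one> \<otimes> x \<otimes> k" using x_in_G H_sub by simp_all
  then show ?thesis using H_one unfolding ball_def by blast
qed (simp add: ball_def)

text \<open>
  Each element of \<open>S\<close> outside \<open>H\<close> can be written with \<open>x\<close> on either side, so in a product of
  three factors two adjacent ones outside \<open>H\<close> collapse to an element of \<open>H\<close>. Only
  \<open>x H x = x H x\<^sup>-\<^sup>1\<close> can then leave the ball.
\<close>

lemma S_cubed_subset: "S <#> S <#> S \<subseteq> ball \<union> conj_H"
proof -
  have "a \<otimes> b \<otimes> c \<in> ball \<union> conj_H" if abc: "a \<in> S" "b \<in> S" "c \<in> S" for a b c
  proof -
    have carr: "a \<in> carrier G" "b \<in> carrier G" "c \<in> carrier G" using abc S_sub by auto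
    have two: "u \<otimes> v \<in> H" if uv: "u \<in> S" "u \<notin> H" "v \<in> S" "v \<notin> H" for u v
    proof -
      obtain l k where "l \<in> H" "u = l \<otimes> x" "k \<in> H" "v = x \<otimes> k"
        using S_minus_H[OF uv(1,2)] S_minus_H[OF uv(3,4)] by blast
      then have "u \<otimes> v = l \<otimes> (x \<otimes> x) \<otimes> k" using x_in_G H_sub by (simp add: m_assoc)
      then show ?thesis using \<open>l \<in> H\<close> \<open>k \<in> H\<close> square_in_H H_closed by simp
    qed
    consider "a \<in> H" "b \<in> H" | "a \<in> H" "c \<in> H" | "b \<in> H" "c \<in> H"
      | "a \<notin> H" "b \<notin> H" | "b \<notin> H" "c \<notin> H" | "a \<notin> H" "b \<in> H" "c \<notin> H" by blast
    then show ?thesis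
    proof cases
      case 1 then show ?thesis using abc S_sub_ball ball_mult_left H_closed by blast
    next
      case 2 then show ?thesis using abc S_sub_ball ball_mult_left ball_mult_right by blast
    next
      case 3 then show ?thesis using abc S_sub_ball ball_mult_right by blast
    next
      case 4
      then have "a \<otimes> b \<in> H" using two abc by blast
      then show ?thesis using abc S_sub_ball ball_mult_left by blast
    next
      case 5
      then have "b \<otimes> c \<in> H" using two abc by blast
      then show ?thesis using abc carr S_sub_ball ball_mult_right by (simp add: m_assoc)
    next
      case 6
      obtain k l where kl: "k \<in> H" "l \<in> H" "a = x \<otimes> k" "c = l \<otimes> x"
        using S_minus_H[OF abc(1)] S_minus_H[OF abc(3)] 6 by blast
      then have "inv x \<otimes> (a \<otimes> b \<otimes> c) \<otimes> x = k \<otimes> b \<otimes> l \<otimes> (x \<otimes> x)"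
        using x_in_G H_sub 6 by (simp add: group_simps)
      then show ?thesis
        using kl 6 square_in_H H_closed carr by (simp add: conj_H_def)
    qed
  qed
  then show ?thesis by (auto simp: set_mult_def)
qed

lemma card_S_cubed: "card (S <#> S <#> S) \<le> 14 * card M"
proof -
  have "card (S <#> S <#> S) \<le> card (ball \<union> (conj_H - ball))"
    using S_cubed_subset finite_ball finite_conj_H by (intro card_mono) auto
  also have "\<dots> \<le> card ball + card (conj_H - ball)" by (rule card_Un_le)
  finally show ?thesis
    using card_ball card_conj_H_minus[of ball] by (auto simp: ball_def)
qed

text \<open>
  If \<open>far\<close> is empty then \<open>x H x \<subseteq> H \<union> H x H\<close>, which is what is needed for the ball to be closed under
  multiplication.
\<close>

lemma ball_eq_carrier:
  assumes "generate G (H \<union> {x}) = carrier G" "far = {}"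
  shows "ball = carrier G"
proof -
  have xhx: "x \<otimes> h \<otimes> x \<in> ball" if h: "h \<in> H" for h
  proof -
    have "inv x \<otimes> (x \<otimes> h \<otimes> x) \<otimes> x = h \<otimes> (x \<otimes> x)"
      using h x_in_G H_sub by (simp add: group_simps)
    then have "x \<otimes> h \<otimes> x \<in> conj_H"
      using h x_in_G H_sub H_closed square_in_H by (simp add: conj_H_def)
    then show ?thesis using assms by (auto simp: far_def)
  qed
  have "subgroup ball G"
  proof (rule subgroupI)
    fix a b assume ab: "a \<in> ball" "b \<in> ball"
    then consider "a \<in> H" | "b \<in> H" | h k h' k' where "h \<in> H" "k \<in> H" "a = h \<otimes> x \<otimes> k"
      "h' \<in> H" "k' \<in> H" "b = h' \<otimes> x \<otimes> k'" unfolding ball_def by blast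
    then show "a \<otimes> b \<in> ball"
    proof cases
      case 3
      then have "a \<otimes> b = h \<otimes> (x \<otimes> (k \<otimes> h') \<otimes> x) \<otimes> k'"
        using x_in_G H_sub by (simp add: m_assoc)
      then show ?thesis
        using 3 xhx[of "k \<otimes> h'"] H_closed ball_mult_left ball_mult_right by simp
    qed (use ab ball_mult_left ball_mult_right in auto)
  qed (use ball_sub inv_ball H_one in \<open>auto simp: ball_def\<close>)
  moreover have "H \<union> {x} \<subseteq> ball"
    using S_sub_ball subgroup.one_closed[OF subgroup_M] x_in_G by (force simp: S_eq)
  ultimately have "carrier G \<subseteq> ball"
    using generate_subgroup_incl assms(1) by metis
  then show ?thesis using ball_sub by blast
qed

lemma card_carrier_update: "Coset.order (G\<lparr>carrier := K\<rparr>) = card K"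
  by (simp add: Coset.order_def)

text \<open>
  The index 3 is prime.
\<close>

lemma M_maximal:
  assumes "subgroup K G" "K \<subseteq> H" "M \<subseteq> K" "K \<noteq> M"
  shows "K = H"
proof -
  have finK: "finite K" using assms(2) finite_H by (rule finite_subset)
  have gK: "group (G\<lparr>carrier := K\<rparr>)" using assms(1) by (rule subgroup_imp_group)
  have "subgroup K (G\<lparr>carrier := H\<rparr>)"
    using assms(1) subgroup_H assms(2) by (rule subgroup_incl)
  then have "card K dvd card H"
    using group.lagrange[OF group_H, of K] by (metis dvd_triv_right card_carrier_update)
  moreover have "subgroup M (G\<lparr>carrier := K\<rparr>)"
    using subgroup_M assms(1,3) by (rule subgroup_incl)
  then have "card M dvd card K"
    using group.lagrange[OF gK, of M] by (metis dvd_triv_right card_carrier_update)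
  ultimately obtain i j where ij: "card H = card K * i" "card K = card M * j"
    unfolding dvd_def by blast
  have "card M < card K" using assms finK by (intro psubset_card_mono) auto
  then have j: "j > 1" using ij by (cases j) auto
  have "card M * 3 = card M * (j * i)" using ij card_H card_M_pos by simp
  then have ji: "j * i = 3" using card_M_pos by simp
  then have "j \<le> 3" using dvd_imp_le[of j 3] dvd_triv_left[of j i] by simp
  moreover have "j \<noteq> 2"
  proof
    assume "j = 2"
    then have "2 * i = 3" using ji by simp
    then show False by presburger
  qed
  ultimately have "j = 3" using j by simp
  then have "card K = card H" using ij card_H by simp
  then show ?thesis using assms(2) finite_H by (intro card_subset_eq)
qed

lemma far_sub: "g \<in> far \<Longrightarrow> g \<in> carrier G"
  by (simp add: far_def conj_H_def)

lemma far_mult_left: "m \<in> M \<Longrightarrow> g \<in> far \<Longrightarrow> m \<otimes> g \<in> far"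
proof -
  assume m: "m \<in> M" and g: "g \<in> far"
  then have "m \<otimes> g \<in> conj_H"
    using subgroup.m_closed[OF subgroup_conj_H, of m g] by (simp add: far_def M_def)
  moreover have "m \<otimes> g \<notin> ball"
    using ball_cancel_left[of m g] m g far_sub[OF g] by (auto simp: far_def M_def)
  ultimately show ?thesis by (simp add: far_def)
qed

lemma far_mult_right: "m \<in> M \<Longrightarrow> g \<in> far \<Longrightarrow> g \<otimes> m \<in> far"
proof -
  assume m: "m \<in> M" and g: "g \<in> far"
  then have "g \<otimes> m \<in> conj_H"
    using subgroup.m_closed[OF subgroup_conj_H, of g m] by (simp add: far_def M_def)
  moreover have "g \<otimes> m \<notin> ball"
    using ball_cancel_right[of m g] m g far_sub[OF g] by (auto simp: far_def M_def)
  ultimately show ?thesis by (simp add: far_def)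
qed

text \<open>
  If \<open>h\<close> preserved \<open>far\<close>, the stabiliser of \<open>far\<close> in \<open>H\<close> would exceed \<open>M\<close> and so be all of \<open>H\<close>. Then
  \<open>far\<close> would contain a right coset of \<open>H\<close>, which is larger than \<open>far\<close>.
\<close>

lemma far_translate:
  assumes "far \<noteq> {}" "h \<in> H" "h \<notin> M"
  shows "\<exists>g\<in>far. h \<otimes> g \<notin> far"
proof (rule ccontr)
  assume "\<not> ?thesis"
  then have hfar: "\<And>g. g \<in> far \<Longrightarrow> h \<otimes> g \<in> far" by blast
  have finfar: "finite far" using finite_conj_H by (simp add: far_def)
  define K where "K = {k \<in> H. \<forall>g\<in>far. k \<otimes> g \<in> far}"
  have K: "k \<in> H" "k \<in> carrier G" "\<And>g. g \<in> far \<Longrightarrow> k \<otimes> g \<in> far" if "k \<in> K" for k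
    using that H_sub by (auto simp: K_def)
  have h_in_K: "h \<in> K" using assms(2) hfar by (simp add: K_def)
  have "subgroup K G"
  proof (rule subgroupI)
    show "K \<noteq> {}" using h_in_K by blast
    show "K \<subseteq> carrier G" using K(2) by blast
  next
    fix a assume a: "a \<in> K"
    have onto: "(\<lambda>g. a \<otimes> g) ` far = far"
      using card_l_translate[of a far] K[OF a] far_sub finfar
      by (intro card_subset_eq) blast+
    have "inv a \<otimes> g \<in> far" if "g \<in> far" for g
    proof -
      have "g \<in> (\<lambda>g. a \<otimes> g) ` far" using that onto by simp
      then obtain g' where g': "g' \<in> far" "g = a \<otimes> g'" by (rule imageE)
      then show ?thesis using K[OF a] far_sub[of g'] by (simp add: cancel_inv_left)
    qed
    then show "inv a \<in> K" using K[OF a] H_inv by (simp add: K_def)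
  next
    fix a b assume a: "a \<in> K" and b: "b \<in> K"
    then have "a \<otimes> b \<otimes> g \<in> far" if "g \<in> far" for g
      using that K[OF a] K[OF b] far_sub[OF that] by (simp add: m_assoc)
    then show "a \<otimes> b \<in> K" using K[OF a] K[OF b] H_closed by (simp add: K_def)
  qed
  moreover have "M \<subseteq> K"
  proof
    fix m assume "m \<in> M"
    then show "m \<in> K" using far_mult_left by (simp add: K_def M_def)
  qed
  moreover have "K \<noteq> M" using h_in_K assms(3) by blast
  moreover have "K \<subseteq> H" using K(1) by blast
  ultimately have "K = H" by (intro M_maximal)
  then have all: "k \<otimes> g \<in> far" if "k \<in> H" "g \<in> far" for k g using that K(3) by simp
  obtain g where g: "g \<in> far" using assms by blast
  have "card H = card ((\<lambda>k. k \<otimes> g) ` H)"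
    by (rule card_image[symmetric]) (use g far_sub H_sub in \<open>auto intro!: inj_onI\<close>)
  also have "\<dots> \<le> card far" using finfar all g by (intro card_mono) auto
  also have "\<dots> \<le> 2 * card M" unfolding far_def by (rule card_conj_H_minus) (auto simp: ball_def)
  finally show False using card_H card_M_pos by simp
qed

lemma set_mult3I: "a \<in> A \<Longrightarrow> b \<in> A \<Longrightarrow> c \<in> A \<Longrightarrow> a \<otimes> b \<otimes> c \<in> A <#> A <#> A"
  by (auto simp: set_mult_def)

text \<open>
  The witnesses are the elements of \<open>H y\<close> that do not fix \<open>w\<close>.
\<close>

lemma many_new_products_outside_ball:
  assumes y: "y \<in> carrier G" "y \<notin> ball" and T: "insert y S \<subseteq> T"
  shows "\<exists>B \<subseteq> T <#> T <#> T. B \<inter> (S <#> S <#> S) = {} \<and> card M \<le> card B"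
proof -
  let ?C = "(\<lambda>h. h \<otimes> y) ` H"
  have "h \<otimes> y \<in> T <#> T <#> T" if "h \<in> H" for h
  proof -
    have "h \<otimes> y = \<one> \<otimes> h \<otimes> y" using that H_sub by simp
    then show ?thesis using that T H_one set_mult3I[of \<one> T h y] by (auto simp: S_def)
  qed
  then have "?C \<subseteq> T <#> T <#> T" by blast
  moreover have Cball: "?C \<inter> ball = {}" using y ball_cancel_left by blast
  have "(?C - conj_H) \<inter> (S <#> S <#> S) = {}" using S_cubed_subset Cball by blast
  moreover have "card M \<le> card (?C - conj_H)"
  proof -
    have "card ?C = card H"
      by (rule card_image) (use y H_sub in \<open>auto intro!: inj_onI\<close>)
    moreover have "card (?C \<inter> conj_H) \<le> card (conj_H - ball)"
      using Cball finite_conj_H by (intro card_mono) auto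
    moreover have "card (conj_H - ball) \<le> 2 * card M"
      by (rule card_conj_H_minus) (auto simp: ball_def)
    ultimately show ?thesis
      using card_Diff_subset_Int[of ?C conj_H] finite_H card_H by simp
  qed
  ultimately show ?thesis by blast
qed

text \<open>
  For \<open>g \<in> far\<close> with \<open>h g \<notin> far\<close>, the coset \<open>h g M\<close> consists of new products: it is contained in
  \<open>h x H x = (h x k) H x\<close>, and it misses both the ball and \<open>conj_H\<close>.
\<close>

lemma many_new_products_inside_ball:
  assumes "far \<noteq> {}" and hk: "h \<in> H" "h \<notin> M" "k \<in> H" and T: "insert (h \<otimes> x \<otimes> k) S \<subseteq> T"
  shows "\<exists>B \<subseteq> T <#> T <#> T. B \<inter> (S <#> S <#> S) = {} \<and> card M \<le> card B"
proof -
  obtain g where g: "g \<in> far" "h \<otimes> g \<notin> far" using far_translate assms by blast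
  let ?B = "(\<lambda>m. (h \<otimes> g) \<otimes> m) ` M"
  have gG: "g \<in> carrier G" "h \<in> carrier G" using g hk far_sub H_sub by auto
  have new: "h \<otimes> g \<otimes> m \<notin> ball \<union> conj_H" if m: "m \<in> M" for m
  proof
    assume *: "h \<otimes> g \<otimes> m \<in> ball \<union> conj_H"
    have gm: "g \<otimes> m \<in> far" using far_mult_right g m by blast
    have "h \<otimes> g \<otimes> m \<notin> ball"
      using gm ball_cancel_left[of h "g \<otimes> m"] hk gG m M_sub by (auto simp: far_def m_assoc)
    then have "h \<otimes> g \<otimes> m \<in> far" using * by (simp add: far_def)
    then have "h \<otimes> g \<otimes> m \<otimes> inv m \<in> far"
      using m subgroup.m_inv_closed[OF subgroup_M] far_mult_right by blast
    then show False using g gG m M_sub by (simp add: group_simps)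
  qed
  have "h \<otimes> g \<otimes> m \<in> T <#> T <#> T" if m: "m \<in> M" for m
  proof -
    have "g \<otimes> m \<in> far" using far_mult_right g m by blast
    then have c: "inv x \<otimes> (g \<otimes> m) \<otimes> x \<in> H" by (simp add: far_def conj_H_def)
    let ?l = "inv k \<otimes> (inv x \<otimes> (g \<otimes> m) \<otimes> x) \<otimes> inv (x \<otimes> x)"
    have "?l \<in> H" using c hk square_in_H H_inv H_closed by simp
    moreover have "h \<otimes> g \<otimes> m = (h \<otimes> x \<otimes> k) \<otimes> ?l \<otimes> x"
      using gG hk H_sub m M_sub x_in_G by (simp add: group_simps)
    moreover have "x \<in> S" using x_in_G subgroup.one_closed[OF subgroup_M] by (force simp: S_eq)
    ultimately show ?thesis using T set_mult3I[of "h \<otimes> x \<otimes> k" T ?l x] by (auto simp: S_def)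
  qed
  then have "?B \<subseteq> T <#> T <#> T" by blast
  moreover have "?B \<inter> (S <#> S <#> S) = {}" using new S_cubed_subset by blast
  moreover have "card ?B = card M" using card_l_translate[of "h \<otimes> g" M] gG M_sub by auto
  ultimately show ?thesis by (metis le_refl)
qed

text \<open>
  For \<open>y = h x k\<close> in the ball, \<open>y\<^sup>-\<^sup>1\<close> has the form \<open>k\<^sup>-\<^sup>1 x (x\<^sup>-\<^sup>2 h\<^sup>-\<^sup>1)\<close>. As \<open>y\<close> is not in \<open>x M\<close>,
  one of \<open>h\<close> and \<open>k\<^sup>-\<^sup>1\<close> is outside \<open>M\<close>, and the corresponding element of \<open>T\<close> yields new products.
\<close>

theorem card_S_cubed_less:
  assumes "far \<noteq> {}" "y \<in> carrier G" "y \<notin> S" and T: "T = S \<union> {y, inv y}"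
  shows "card (S <#> S <#> S) + card M \<le> card (T <#> T <#> T)"
proof -
  have "\<exists>B \<subseteq> T <#> T <#> T. B \<inter> (S <#> S <#> S) = {} \<and> card M \<le> card B"
  proof (cases "y \<in> ball")
    case False
    show ?thesis
      by (rule many_new_products_outside_ball[OF assms(2) False]) (auto simp: T)
  next
    case True
    then obtain h k where hk: "h \<in> H" "k \<in> H" "y = h \<otimes> x \<otimes> k"
      using assms(3) unfolding ball_def S_def by blast
    show ?thesis
    proof (cases "h \<in> M")
      case False
      show ?thesis
        by (rule many_new_products_inside_ball[OF assms(1) hk(1) False hk(2)]) (auto simp: T hk(3))
    next
      case True
      have inv_k: "inv k \<notin> M"
      proof
        assume "inv k \<in> M"
        then have k: "k \<in> M"
          using subgroup.m_inv_closed[OF subgroup_M, of "inv k"] hk H_sub by simp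
        have "inv x \<otimes> h \<otimes> x \<in> M"
        proof -
          have "inv x \<otimes> h \<otimes> x \<in> H" using True by (simp add: M_def conj_H_def)
          moreover have "x \<otimes> (inv x \<otimes> h \<otimes> x) \<otimes> inv x = h" using hk x_in_G H_sub
            by (simp add: group_simps)
          ultimately show ?thesis
            using hk H_sub conj_mem_H_iff[of "inv x \<otimes> h \<otimes> x"] by (simp add: M_def conj_H_def)
        qed
        then have "(inv x \<otimes> h \<otimes> x) \<otimes> k \<in> M" using k subgroup.m_closed[OF subgroup_M] by blast
        moreover have "y = x \<otimes> ((inv x \<otimes> h \<otimes> x) \<otimes> k)"
          using hk H_sub x_in_G by (simp add: group_simps)
        ultimately show False using assms(3) by (simp add: S_eq)
      qed
      have inv_y: "inv y = inv k \<otimes> x \<otimes> (inv (x \<otimes> x) \<otimes> inv h)"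
        using hk H_sub x_in_G by (simp add: group_simps)
      have "inv (x \<otimes> x) \<otimes> inv h \<in> H" using hk H_inv H_closed square_in_H by blast
      then show ?thesis
        by (rule many_new_products_inside_ball[OF assms(1) H_inv[OF hk(2)] inv_k])
           (auto simp: T inv_y)
    qed
  qed
  then obtain B where B: "B \<subseteq> T <#> T <#> T" "B \<inter> (S <#> S <#> S) = {}" "card M \<le> card B"
    by blast
  have "T \<subseteq> carrier G" using assms(2) S_sub T by auto
  then have "T <#> T <#> T \<subseteq> carrier G" by (intro set_mult_closed)
  then have fin: "finite (T <#> T <#> T)" using finite_G finite_subset by blast
  have sub: "S <#> S <#> S \<subseteq> T <#> T <#> T" using T by (intro mono_set_mult) auto
  have "card (S <#> S <#> S) + card B = card ((S <#> S <#> S) \<union> B)"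
    using B fin sub by (intro card_Un_disjoint[symmetric]) (auto intro: finite_subset)
  also have "\<dots> \<le> card (T <#> T <#> T)" using B fin sub by (intro card_mono) auto
  finally show ?thesis using B by simp
qed

end

section \<open>The numerical inequality\<close>

text \<open>
  With \<open>L = ln 64\<close>: from \<open>224 \<le> 64\<^sup>4\<^sup>/\<^sup>3 = 256\<close> one has \<open>ln N \<le> 4L/3\<close>. Passing from 64 to at most 66
  adds at most \<open>1/32\<close> to the logarithm, and passing from \<open>N\<close> to \<open>N'\<close> adds at least \<open>1/15\<close>. The claim
  is then \<open>1/32 \<cdot> 4/3 < 1/15\<close>.
\<close>

lemma log_ratio_less:
  fixes N N' t :: nat
  assumes "0 < N" "N \<le> 224" "N + 16 \<le> N'" "65 \<le> t" "t \<le> 66"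
  shows "ln (real N) / ln 64 < ln (real N') / ln (real t)"
proof -
  have l64: "ln (64::real) > 0" by simp
  have "ln (real t) \<le> ln 66" using assms by simp
  also have "\<dots> = ln (64 * (1 + 1 / 32 :: real))" by simp
  also have "\<dots> = ln 64 + ln (1 + 1 / 32)" by (rule ln_mult_pos) simp_all
  also have "\<dots> \<le> ln 64 + 1 / 32" using ln_add_one_self_le_self[of "1/32"] by simp
  finally have t: "ln (real t) \<le> ln 64 + 1 / 32" .
  have "3 * ln (real N) \<le> 3 * ln (256::real)" using assms by simp
  also have "\<dots> = ln (256 ^ 3)" by (subst ln_realpow) auto
  also have "\<dots> = ln (64 ^ 4)" by simp
  also have "\<dots> = 4 * ln 64" by (subst ln_realpow) auto
  finally have N: "ln (real N) \<le> 4 / 3 * ln 64" by simp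
  have "ln (real N / real N') \<le> real N / real N' - 1" using assms by (intro ln_le_minus_one) auto
  also have "\<dots> \<le> - 1 / 15"
  proof -
    have "15 * real N \<le> 14 * real N'" using assms by linarith
    then show ?thesis using assms by (simp add: field_simps)
  qed
  finally have N': "ln (real N') \<ge> ln (real N) + 1 / 15" using assms by (simp add: ln_div)
  have "ln (real N) * ln (real t) \<le> ln (real N) * (ln 64 + 1 / 32)"
    using t assms by (intro mult_left_mono) auto
  also have "\<dots> < (ln (real N) + 1 / 15) * ln 64"
  proof -
    have "ln (real N) / 32 < ln 64 / 15" using N l64 by linarith
    then show ?thesis by (simp add: algebra_simps)
  qed
  also have "\<dots> \<le> ln (real N') * ln 64" using N' l64 by (intro mult_right_mono) auto
  finally show ?thesis using assms by (simp add: field_simps)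
qed

section \<open>Orders of \<open>SL(2,p)\<close> and of the binary octahedral group\<close>

lemma subgroup_scalars_SL2: "subgroup (scalars_SL2 :: ('a::field ^ 2 ^ 2) set) SL2"
proof -
  interpret group "SL2 :: ('a ^ 2 ^ 2) monoid" by (rule group_SL2)
  have scalar_mult: "mat c ** mat d = (mat (c * d) :: 'a ^ 2 ^ 2)" for c d
    by (simp add: vec_eq_iff matrix_matrix_mult_def mat_def sum_2 forall_2)
  show ?thesis
  proof (rule subgroupI)
    have "mat 1 \<in> (scalars_SL2 :: ('a ^ 2 ^ 2) set)"
      by (auto simp: scalars_SL2_def SL2_def)
    then show "scalars_SL2 \<noteq> ({} :: ('a ^ 2 ^ 2) set)" by blast
  next
    fix A :: "'a ^ 2 ^ 2" assume "A \<in> scalars_SL2"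
    then obtain c where A: "A \<in> carrier SL2" "A = mat c" by (auto simp: scalars_SL2_def)
    then have "c * c = 1" by (simp add: SL2_def det_2 mat_def)
    then have "A \<otimes>\<^bsub>SL2\<^esub> A = \<one>\<^bsub>SL2\<^esub>" using A scalar_mult by (simp add: SL2_def)
    then have "inv\<^bsub>SL2\<^esub> A = A" using A by (intro inv_equality)
    then show "inv\<^bsub>SL2\<^esub> A \<in> scalars_SL2" using \<open>A \<in> scalars_SL2\<close> by simp
  next
    fix A B :: "'a ^ 2 ^ 2" assume "A \<in> scalars_SL2" "B \<in> scalars_SL2"
    then show "A \<otimes>\<^bsub>SL2\<^esub> B \<in> scalars_SL2"
      using scalar_mult by (auto simp: scalars_SL2_def SL2_def det_mul)
  qed (auto simp: scalars_SL2_def)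
qed

lemma scalars_SL2_eq: "(scalars_SL2 :: ('a::field ^ 2 ^ 2) set) = {mat 1, mat (-1)}"
proof -
  have "det (mat c :: 'a ^ 2 ^ 2) = c\<^sup>2" for c by (simp add: det_2 mat_def power2_eq_square)
  then show ?thesis by (auto simp: scalars_SL2_def SL2_def power2_eq_1_iff)
qed

text \<open>
  The preimage of \<open>K\<close> is the union of its elements, which are cosets of the scalars.
\<close>

lemma card_preimage_PSL2:
  assumes "subgroup K (PSL2 :: ('a::{field,finite} ^ 2 ^ 2) set monoid)"
  shows "card {A \<in> carrier SL2. proj_SL2 A \<in> K} = card (scalars_SL2 :: ('a ^ 2 ^ 2) set) * card K"
proof -
  interpret group "SL2 :: ('a ^ 2 ^ 2) monoid" by (rule group_SL2)
  let ?Z = "scalars_SL2 :: ('a ^ 2 ^ 2) set"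
  have Z: "subgroup ?Z SL2" by (rule subgroup_scalars_SL2)
  have K: "K \<subseteq> rcosets\<^bsub>SL2\<^esub> ?Z"
    using subgroup.subset[OF assms] by (simp add: PSL2_def FactGroup_def)
  have "{A \<in> carrier SL2. proj_SL2 A \<in> K} = \<Union>K"
  proof (intro equalityI subsetI)
    fix A assume A: "A \<in> {A \<in> carrier SL2. proj_SL2 A \<in> K}"
    then have "A \<in> proj_SL2 A" using rcos_self[OF _ Z] by (simp add: proj_SL2_def)
    then show "A \<in> \<Union>K" using A by blast
  next
    fix A assume "A \<in> \<Union>K"
    then obtain C where C: "A \<in> C" "C \<in> K" by blast
    then obtain B where B: "B \<in> carrier SL2" "C = ?Z #>\<^bsub>SL2\<^esub> B"
      using K by (auto simp: RCOSETS_def)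
    then have "C = ?Z #>\<^bsub>SL2\<^esub> A" using repr_independence C Z by blast
    moreover have "A \<in> carrier SL2"
      using C K rcosets_part_G[OF Z] by blast
    ultimately show "A \<in> {A \<in> carrier SL2. proj_SL2 A \<in> K}" using C by (simp add: proj_SL2_def)
  qed
  moreover have "card ?Z * card K = card (\<Union>K)"
  proof (rule card_partition)
    show "card C = card ?Z" if "C \<in> K" for C
      using that K card_rcosets_equal subgroup.subset[OF Z] by (metis subsetD)
    show "C \<inter> C' = {}" if "C \<in> K" "C' \<in> K" "C \<noteq> C'" for C C'
      using rcos_disjoint[OF Z] that K by (auto simp: pairwise_def disjnt_def)
  qed auto
  ultimately show ?thesis by simp
qed

lemma card_matrices: "CARD('p::finite mod_ring ^ 2 ^ 2) = CARD('p) ^ 4"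
  by (simp flip: power_mult)

text \<open>
  The preimage has order \<open>24 |Z|\<close>, where \<open>Z = {1, -1}\<close>. For \<open>p = 2\<close> the two scalars coincide, but
  there are only 16 matrices, too few for 24 elements.
\<close>

lemma card_double_cover_S4:
  fixes H :: "('p::prime_card mod_ring ^ 2 ^ 2) set"
  assumes "iso_double_cover_S4 (SL2\<lparr>carrier := H\<rparr>)"
  shows "card H = 48"
proof -
  obtain K where K: "subgroup K (PSL2 :: ('p mod_ring ^ 2 ^ 2) set monoid)"
      "PSL2\<lparr>carrier := K\<rparr> \<cong> sym_group 4"
      "SL2\<lparr>carrier := H\<rparr> \<cong> SL2\<lparr>carrier := {A \<in> carrier SL2. proj_SL2 A \<in> K}\<rparr>"
    using assms unfolding iso_double_cover_S4_def by blast
  have "card K = card {p. p permutes {1..4::nat}}"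
    using iso_same_card[OF K(2)] by (simp add: sym_group_def)
  then have "card K = 24" by (simp add: card_permutations[of _ 4] fact_numeral)
  then have H: "card H = 24 * card (scalars_SL2 :: ('p mod_ring ^ 2 ^ 2) set)"
    using iso_same_card[OF K(3)] card_preimage_PSL2[OF K(1)] by simp
  have "(1 :: 'p mod_ring) \<noteq> -1"
  proof
    assume eq: "(1 :: 'p mod_ring) = -1"
    then have "1 + 1 = (0 :: 'p mod_ring)" by (metis add.right_inverse)
    then have "of_nat 2 = (0 :: 'p mod_ring)" by simp
    then have "CARD('p) dvd 2" by (rule of_nat_0_mod_ring_dvd)
    then have "CARD('p) \<le> 2" by (rule dvd_imp_le) simp
    then have "CARD('p) ^ 4 \<le> 2 ^ 4" by (rule power_mono) simp
    moreover have "card H \<le> CARD('p mod_ring ^ 2 ^ 2)" by (intro card_mono) auto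
    then have "card H \<le> CARD('p) ^ 4" by (simp only: card_matrices)
    moreover have "card H = 24" using H eq by (simp add: scalars_SL2_eq)
    ultimately show False by simp
  qed
  then have "mat 1 \<noteq> (mat (-1) :: 'p mod_ring ^ 2 ^ 2)"
    by (simp add: vec_eq_iff mat_def forall_2)
  then show ?thesis using H by (simp add: scalars_SL2_eq)
qed

text \<open>
  The upper unitriangular matrices form a subgroup of order \<open>p\<close>.
\<close>

lemma characteristic_dvd_order_SL2: "CARD('p) dvd Coset.order (SL2 :: ('p::prime_card mod_ring ^ 2 ^ 2) monoid)"
proof -
  interpret group "SL2 :: ('p mod_ring ^ 2 ^ 2) monoid" by (rule group_SL2)
  define u :: "'p mod_ring \<Rightarrow> 'p mod_ring ^ 2 ^ 2" where "u t = vector [vector [1, t], vector [0, 1]]" for t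
  have u_mult: "u s ** u t = u (s + t)" for s t
    by (simp add: u_def vec_eq_iff matrix_matrix_mult_def sum_2 forall_2)
  have u_zero: "u 0 = mat 1" by (simp add: u_def vec_eq_iff mat_def forall_2)
  have u_det: "u t \<in> carrier SL2" for t by (simp add: u_def SL2_def det_2)
  have "subgroup (range u) SL2"
  proof (rule subgroupI)
    fix A assume "A \<in> range u"
    then obtain t where A: "A = u t" by blast
    have "inv\<^bsub>SL2\<^esub> A = u (- t)"
      using u_det[of t] u_det[of "-t"] u_mult[of "-t" t] u_zero A
      by (intro inv_equality) (auto simp: SL2_def)
    then show "inv\<^bsub>SL2\<^esub> A \<in> range u" by simp
  next
    fix A B assume "A \<in> range u" "B \<in> range u"
    then show "A \<otimes>\<^bsub>SL2\<^esub> B \<in> range u" using u_mult by (auto simp: SL2_def)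
  qed (use u_det in auto)
  then have "card (range u) dvd Coset.order (SL2 :: ('p mod_ring ^ 2 ^ 2) monoid)"
    using lagrange by (metis dvd_triv_right)
  moreover have "inj u" by (rule injI) (metis u_def vector_2)
  then have "card (range u) = CARD('p)" by (simp add: card_image)
  ultimately show ?thesis by simp
qed

text \<open>
  A multiple of 48 up to 192 has only 2 and 3 as prime divisors, so \<open>p \<le> 3\<close>, and there are
  at most \<open>3\<^sup>4 = 81\<close> matrices; hence the order is 48 at most.
\<close>

lemma small_order_SL2:
  assumes "48 dvd Coset.order (SL2 :: ('p::prime_card mod_ring ^ 2 ^ 2) monoid)"
    and "Coset.order (SL2 :: ('p mod_ring ^ 2 ^ 2) monoid) \<le> 192"
  shows "Coset.order (SL2 :: ('p mod_ring ^ 2 ^ 2) monoid) \<le> 48"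
proof -
  let ?n = "Coset.order (SL2 :: ('p mod_ring ^ 2 ^ 2) monoid)" and ?p = "CARD('p)"
  interpret group "SL2 :: ('p mod_ring ^ 2 ^ 2) monoid" by (rule group_SL2)
  have p: "prime ?p" by (rule prime_card)
  obtain k where k: "?n = 48 * k" using assms(1) by (auto simp: dvd_def)
  moreover have "?n > 0" by (simp add: order_gt_0_iff_finite)
  ultimately have "k \<in> {1,2,3,4}" using assms(2) by auto
  then have "?n dvd 2 ^ 6 * 3 ^ 2" using k by auto
  then have "?p dvd 2 ^ 6 * 3 ^ 2" using characteristic_dvd_order_SL2 dvd_trans by blast
  then have "?p dvd 2 \<or> ?p dvd 3" using p by (metis prime_dvd_mult_iff prime_dvd_power)
  then have "?p \<le> 3" using dvd_imp_le[of ?p 2] dvd_imp_le[of ?p 3] by auto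
  then have "?p ^ 4 \<le> 3 ^ 4" by (rule power_mono) simp
  moreover have "?n \<le> CARD('p mod_ring ^ 2 ^ 2)" unfolding Coset.order_def by (intro card_mono) auto
  then have "?n \<le> ?p ^ 4" by (simp only: card_matrices)
  ultimately have "48 * k \<le> 81" using k by simp
  then show ?thesis using k by simp
qed

section \<open>Comparison of the tripling exponents\<close>

theorem theorem7p1:
  fixes H S T :: "('p::prime_card mod_ring ^ 2 ^ 2) set"
    and x y :: "'p mod_ring ^ 2 ^ 2"
  assumes "subgroup H SL2"
    and "iso_double_cover_S4 (SL2\<lparr>carrier := H\<rparr>)"
    and "x \<in> carrier SL2"
    and "generate SL2 (H \<union> {x}) = carrier SL2"
    and "x [^]\<^bsub>SL2\<^esub> (2::nat) \<in> H"
    and "subgroup_index SL2 H (((inv\<^bsub>SL2\<^esub> x <#\<^bsub>SL2\<^esub> H) #>\<^bsub>SL2\<^esub> x) \<inter> H) = 3"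
    and "S = H \<union> ((x <#\<^bsub>SL2\<^esub> H) \<inter> (H #>\<^bsub>SL2\<^esub> x))"
    and "y \<in> carrier SL2"
    and "y \<notin> S"
    and "T = S \<union> {y, inv\<^bsub>SL2\<^esub> y}"
  shows "tripling_exponent SL2 T > tripling_exponent SL2 S"
proof -
  interpret group "SL2 :: ('p mod_ring ^ 2 ^ 2) monoid" by (rule group_SL2)
  have square: "x \<otimes>\<^bsub>SL2\<^esub> x \<in> H"
    using assms(3,5) by (simp add: numeral_2_eq_2)
  interpret pair: index_three_pair "SL2 :: ('p mod_ring ^ 2 ^ 2) monoid" H x
    by (intro index_three_pair.intro index_three_pair_axioms.intro group_SL2 assms(1,3,6) square) simp
  have S: "S = pair.S" using assms(7) by (simp only: pair.S_def)
  have cardM: "card pair.M = 16" using card_double_cover_S4[OF assms(2)] pair.card_H by simp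
  then have card_S: "card S = 64" using pair.card_S S by simp
  have "pair.far \<noteq> {}"
  proof
    assume "pair.far = {}"
    then have "pair.ball = carrier SL2" using assms(4) by (intro pair.ball_eq_carrier)
    then have "Coset.order (SL2 :: ('p mod_ring ^ 2 ^ 2) monoid) \<le> 192"
      using pair.card_ball cardM by (simp add: Coset.order_def)
    moreover have "48 dvd Coset.order (SL2 :: ('p mod_ring ^ 2 ^ 2) monoid)"
      using lagrange[OF assms(1)] card_double_cover_S4[OF assms(2)] by (metis dvd_triv_right)
    ultimately have "Coset.order (SL2 :: ('p mod_ring ^ 2 ^ 2) monoid) \<le> 48"
      by (intro small_order_SL2)
    moreover have "card S \<le> Coset.order (SL2 :: ('p mod_ring ^ 2 ^ 2) monoid)"
      unfolding Coset.order_def using pair.S_sub S by (intro card_mono) auto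
    ultimately show False using card_S by simp
  qed
  moreover have "y \<notin> pair.S" using assms(9) S by simp
  moreover have "T = pair.S \<union> {y, inv\<^bsub>SL2\<^esub> y}" using assms(10) S by simp
  ultimately have "card (S <#>\<^bsub>SL2\<^esub> S <#>\<^bsub>SL2\<^esub> S) + 16 \<le> card (T <#>\<^bsub>SL2\<^esub> T <#>\<^bsub>SL2\<^esub> T)"
    using pair.card_S_cubed_less[OF _ assms(8)] cardM S by simp
  moreover have "card (S <#>\<^bsub>SL2\<^esub> S <#>\<^bsub>SL2\<^esub> S) \<le> 224"
    using pair.card_S_cubed cardM S by simp
  moreover have "S <#>\<^bsub>SL2\<^esub> S <#>\<^bsub>SL2\<^esub> S \<noteq> {}"
    using card_S by (fastforce simp: set_mult_def)
  then have "0 < card (S <#>\<^bsub>SL2\<^esub> S <#>\<^bsub>SL2\<^esub> S)" by (simp add: card_gt_0_iff)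
  moreover have "65 \<le> card T"
  proof -
    have "card (insert y S) \<le> card T" using assms(10) by (intro card_mono) auto
    then show ?thesis using assms(9) card_S by simp
  qed
  moreover have "card T \<le> 66"
    using card_Un_le[of S "{y, inv\<^bsub>SL2\<^esub> y}"] card_insert_le_m1[of 2 "{inv\<^bsub>SL2\<^esub> y}" y]
    by (simp add: assms(10) card_S)
  ultimately show ?thesis
    unfolding tripling_exponent_def card_S using log_ratio_less by simp
qed

end
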